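(* For every integer $n\geq 1$ there exists a metric $\rho$ on the set $\mathbb{R}^n$ (not required to induce the Euclidean topology) such that $\mathcal{H}^n_\rho(\mathbb{R}^n)=0$.
   Context: For a metric space $(X,\mathrm{d})$, a positive integer $n$ and a subset $A\subseteq X$, the $n$-dimensional Hausdorff outer measure of $A$ (without any normalizing dimensional constant) is $$\mathcal{H}^n_{\mathrm{d}}(A):=\sup_{\delta>0}\mathcal{H}^n_{\delta,\mathrm{d}}(A),\qquad \mathcal{H}^n_{\delta,\mathrm{d}}(A):=\inf\Bigl\{\sum_{i\in I}\operatorname{diam}(A_i)^n\;:\;A\subseteq\bigcup_{i\in I}A_i,\ \operatorname{diam}(A_i)\leq\delta \text{ for all } i\in I\Bigr\},$$ where the infimum is over all at most countable families $(A_i)_{i\in I}$ of subsets of $X$, and $\operatorname{diam}(U)=\sup_{x,y\in U}\mathrm{d}(x,y)$ (with $\operatorname{diam}(\emptyset)=0$). The value may be $+\infty$. *)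

theory Defs
  imports "HOL-Analysis.Analysis"
begin

text \<open>The diameter takes values in \<^typ>\<open>ennreal\<close> because the library's real-valued
  \<^const>\<open>diameter\<close> is tied to the type-class metric and is not infinite on unbounded sets.
  The supremum over the empty set is 0 in \<^typ>\<open>ennreal\<close>.\<close>

definition ediam :: "('a \<Rightarrow> 'a \<Rightarrow> real) \<Rightarrow> 'a set \<Rightarrow> ennreal" where
  "ediam d U = (SUP (x, y) \<in> U \<times> U. ennreal (d x y))"

text \<open>An at most countable family is indexed by an arbitrary (finite or infinite) set of natural
  numbers. If no admissible cover exists, the infimum is \<^term>\<open>\<infinity> :: ennreal\<close>.\<close>

definition hausdorff_premeasure ::
  "'a set \<Rightarrow> ('a \<Rightarrow> 'a \<Rightarrow> real) \<Rightarrow> nat \<Rightarrow> real \<Rightarrow> 'a set \<Rightarrow> ennreal" where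
  "hausdorff_premeasure X d n \<delta> A =
     Inf {(\<Sum>\<^sub>\<infinity>i\<in>I. ediam d (U i) ^ n) | (I :: nat set) U.
            (\<forall>i\<in>I. U i \<subseteq> X) \<and> A \<subseteq> (\<Union>i\<in>I. U i) \<and> (\<forall>i\<in>I. ediam d (U i) \<le> ennreal \<delta>)}"

definition hausdorff_outer_measure ::
  "'a set \<Rightarrow> ('a \<Rightarrow> 'a \<Rightarrow> real) \<Rightarrow> nat \<Rightarrow> 'a set \<Rightarrow> ennreal" where
  "hausdorff_outer_measure X d n A = (SUP \<delta>\<in>{0<..}. hausdorff_premeasure X d n \<delta> A)"

end

(*
  Only the cardinality of R^n matters: a countable base of the Euclidean topology separates points
  and so embeds R^n, as a set, into the Cantor space of binary sequences. Give two sequences that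
  first differ at index k the distance 4^{-k}. The 2^k cylinders of level k have diameter at most
  4^{-k}, so for n \<ge> 1 they give a cover with sum at most 2^k 4^{-kn} \<le> 2^{-k}.
*)
theory Submission
  imports Defs
begin

text \<open>A point is read as the binary sequence of its memberships in the sets
  \<open>B j\<close>. The first case is split off because \<open>LEAST\<close> is unspecified when
  the sequences agree everywhere. For arbitrary \<open>B\<close> this is only a pseudometric;
  definiteness comes from \<open>B\<close> separating points.\<close>

definition cantor_dist :: "(nat \<Rightarrow> 'a set) \<Rightarrow> 'a \<Rightarrow> 'a \<Rightarrow> real" where
  "cantor_dist B x y =
     (if \<forall>j. x \<in> B j \<longleftrightarrow> y \<in> B j then 0 else (1/4) ^ (LEAST j. (x \<in> B j) \<noteq> (y \<in> B j)))"

lemma cantor_dist_nonneg: "cantor_dist B x y \<ge> 0"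
  by (simp add: cantor_dist_def)

lemma cantor_dist_commute: "cantor_dist B x y = cantor_dist B y x"
proof -
  have "(x \<in> B j) = (y \<in> B j) \<longleftrightarrow> (y \<in> B j) = (x \<in> B j)" for j
    by (rule eq_commute)
  then show ?thesis
    unfolding cantor_dist_def by presburger
qed

text \<open>A first disagreement, if there is one, lies at index k or later. This bounds the
  diameter of a cylinder of level k.\<close>

lemma cantor_dist_le:
  assumes "\<And>j. j < k \<Longrightarrow> x \<in> B j \<longleftrightarrow> y \<in> B j"
  shows "cantor_dist B x y \<le> (1/4) ^ k"
proof (cases "\<forall>j. x \<in> B j \<longleftrightarrow> y \<in> B j")
  case False
  then have "\<exists>j. (x \<in> B j) \<noteq> (y \<in> B j)"
    by blast
  then have "k \<le> (LEAST j. (x \<in> B j) \<noteq> (y \<in> B j))"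
    by (rule LeastI2_ex) (use assms not_le_imp_less in blast)
  then show ?thesis
    using False by (auto simp: cantor_dist_def intro!: power_decreasing)
qed (simp add: cantor_dist_def)

lemma cantor_dist_ge:
  assumes "(x \<in> B j) \<noteq> (y \<in> B j)"
  shows "(1/4) ^ j \<le> cantor_dist B x y"
proof -
  have "(LEAST j. (x \<in> B j) \<noteq> (y \<in> B j)) \<le> j"
    using assms by (rule Least_le)
  then show ?thesis
    using assms by (auto simp: cantor_dist_def intro!: power_decreasing)
qed

text \<open>At the first index j where x and z disagree, y must disagree with x or with z, so one of
  the two distances on the right is at least (1/4)^j.\<close>

lemma cantor_dist_ultra:
  "cantor_dist B x z \<le> max (cantor_dist B x y) (cantor_dist B y z)"
proof (cases "\<forall>j. x \<in> B j \<longleftrightarrow> z \<in> B j")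
  case True
  then have "cantor_dist B x z = 0"
    by (simp add: cantor_dist_def)
  then show ?thesis
    by (simp add: cantor_dist_nonneg le_max_iff_disj)
next
  case False
  define j where "j = (LEAST j. (x \<in> B j) \<noteq> (z \<in> B j))"
  have "\<exists>j. (x \<in> B j) \<noteq> (z \<in> B j)"
    using False by blast
  then have "(x \<in> B j) \<noteq> (z \<in> B j)"
    unfolding j_def by (rule LeastI_ex)
  then consider "(x \<in> B j) \<noteq> (y \<in> B j)" | "(y \<in> B j) \<noteq> (z \<in> B j)"
    by blast
  then have "(1/4) ^ j \<le> max (cantor_dist B x y) (cantor_dist B y z)"
    by cases (rule max.coboundedI1 max.coboundedI2, erule cantor_dist_ge)+
  moreover have "cantor_dist B x z = (1/4) ^ j"
    unfolding cantor_dist_def j_def using False by (rule if_not_P)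
  ultimately show ?thesis
    by (rule ord_eq_le_trans[rotated])
qed

lemma Metric_space_cantor_dist:
  assumes sep: "\<And>x y. x \<noteq> y \<Longrightarrow> \<exists>j. (x \<in> B j) \<noteq> (y \<in> B j)"
  shows "Metric_space UNIV (cantor_dist B)"
proof
  fix x y z
  show "cantor_dist B x y = 0 \<longleftrightarrow> x = y"
    using sep[of x y] by (auto simp: cantor_dist_def)
  show "cantor_dist B x z \<le> cantor_dist B x y + cantor_dist B y z"
    using cantor_dist_ultra[of B x z y] cantor_dist_nonneg[of B x y] cantor_dist_nonneg[of B y z]
    by linarith
qed (rule cantor_dist_nonneg cantor_dist_commute)+

lemma hausdorff_premeasure_cantor_dist_le:
  assumes "n \<ge> 1" and k: "(1/4) ^ k \<le> \<delta>"
  shows "hausdorff_premeasure UNIV (cantor_dist B) n \<delta> A \<le> ennreal ((1/2) ^ k)"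
proof -
  \<comment> \<open>A cylinder of level k is named by the subset of \<open>{..<k}\<close> where its
    sequences take the value true, coded as a natural number because covers are indexed by sets of
    naturals. \<open>U i\<close> ignores decoded elements from k on, so the diameter bound holds for
    every i, not only for those in \<open>I\<close>.\<close>
  define I where "I = set_encode ` Pow {..<k}"
  define U where "U i = {x. \<forall>j<k. x \<in> B j \<longleftrightarrow> j \<in> set_decode i}" for i
  let ?D = "ediam (cantor_dist B)"
  have diam: "?D (U i) \<le> ennreal ((1/4) ^ k)" for i
    unfolding ediam_def
    by (rule SUP_least) (auto simp: U_def intro!: ennreal_leI cantor_dist_le)
  have cover: "A \<subseteq> (\<Union>i\<in>I. U i)"
  proof
    fix x
    \<comment> \<open>The first k memberships of x name its cylinder; this set is finite, so
      \<open>set_decode\<close> recovers it from its code.\<close>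
    let ?J = "{j. j < k \<and> x \<in> B j}"
    have "set_encode ?J \<in> I" "x \<in> U (set_encode ?J)"
      by (auto simp: I_def U_def)
    then show "x \<in> (\<Union>i\<in>I. U i)"
      by blast
  qed
  have "finite I" and card: "card I \<le> 2 ^ k"
    using card_image_le[of "Pow {..<k}" set_encode] by (auto simp: I_def card_Pow)
  have "?D (U i) ^ n \<le> ennreal ((1/4) ^ k)" for i
  proof -
    have "?D (U i) ^ n \<le> ennreal ((1/4) ^ k) ^ n"
      by (intro power_mono diam) simp
    also have "\<dots> = ennreal (((1/4) ^ k) ^ n)"
      by (simp add: ennreal_power)
    \<comment> \<open>Raising a number in [0,1] to an exponent n \<ge> 1 does not increase it; with
      n = 0 every term of the sum would be 1.\<close>
    also have "\<dots> \<le> ennreal ((1/4) ^ k)"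
      using power_decreasing[of 1 n "(1/4::real) ^ k"] \<open>n \<ge> 1\<close>
      by (intro ennreal_leI) (simp add: power_le_one)
    finally show ?thesis .
  qed
  then have "(\<Sum>i\<in>I. ?D (U i) ^ n) \<le> of_nat (card I) * ennreal ((1/4) ^ k)"
    by (intro sum_bounded_above) simp
  also have "\<dots> = ennreal (real (card I) * (1/4) ^ k)"
    by (simp add: ennreal_mult ennreal_of_nat_eq_real_of_nat)
  also have "\<dots> \<le> ennreal (2 ^ k * (1/4) ^ k)"
    using of_nat_mono[OF card, where 'a=real] by (intro ennreal_leI mult_right_mono) simp_all
  also have "2 ^ k * (1/4) ^ k = ((1/2) ^ k :: real)"
    by (simp flip: power_mult_distrib)
  finally have sum_le: "(\<Sum>\<^sub>\<infinity>i\<in>I. ?D (U i) ^ n) \<le> ennreal ((1/2) ^ k)"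
    using \<open>finite I\<close> by simp
  have "?D (U i) \<le> ennreal \<delta>" for i
    using diam[of i] k by (meson ennreal_leI order_trans)
  then have "hausdorff_premeasure UNIV (cantor_dist B) n \<delta> A \<le> (\<Sum>\<^sub>\<infinity>i\<in>I. ?D (U i) ^ n)"
    unfolding hausdorff_premeasure_def using cover
    by (intro Inf_lower CollectI exI[of _ I] exI[of _ U]) simp
  then show ?thesis
    using sum_le by (rule order_trans)
qed

lemma hausdorff_outer_measure_cantor_dist:
  assumes "n \<ge> 1"
  shows "hausdorff_outer_measure UNIV (cantor_dist B) n A = 0"
proof -
  \<comment> \<open>For fixed \<delta> the left side does not depend on k, while the bound (1/2)^k
    holds as soon as (1/4)^k < \<delta>; let k tend to infinity.\<close>
  have "hausdorff_premeasure UNIV (cantor_dist B) n \<delta> A \<le> 0" if "\<delta> > 0" for \<delta>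
  proof (rule tendsto_lowerbound)
    have "(\<lambda>k. ennreal ((1/2) ^ k)) \<longlonglongrightarrow> ennreal 0"
      by (intro tendsto_ennrealI LIMSEQ_power_zero) simp
    then show "(\<lambda>k. ennreal ((1/2) ^ k)) \<longlonglongrightarrow> 0"
      by simp
    have "(\<lambda>k. (1/4) ^ k :: real) \<longlonglongrightarrow> 0"
      by (intro LIMSEQ_power_zero) simp
    then have "\<forall>\<^sub>F k in sequentially. (1/4) ^ k < \<delta>"
      using that by (rule order_tendstoD(2))
    then show "\<forall>\<^sub>F k in sequentially.
        hausdorff_premeasure UNIV (cantor_dist B) n \<delta> A \<le> ennreal ((1/2) ^ k)"
      by eventually_elim (use assms in \<open>simp add: hausdorff_premeasure_cantor_dist_le\<close>)
  qed simp
  then show ?thesis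
    unfolding hausdorff_outer_measure_def by (auto intro!: antisym SUP_least)
qed

text \<open>An open set containing x but not y can be shrunk to a member of a countable base that
  still contains x. Enumerating the base with \<open>from_nat_into\<close> gives the sequence, with
  repetitions if the base is finite.\<close>

lemma countable_separating_sets:
  "\<exists>B :: nat \<Rightarrow> 'a::{second_countable_topology, t2_space} set.
     \<forall>x y. x \<noteq> y \<longrightarrow> (\<exists>j. (x \<in> B j) \<noteq> (y \<in> B j))"
proof -
  obtain \<B> :: "'a set set" where "countable \<B>" and basis: "topological_basis \<B>"
    using ex_countable_basis by blast
  have "\<exists>j. (x \<in> from_nat_into \<B> j) \<noteq> (y \<in> from_nat_into \<B> j)" if "x \<noteq> y" for x y
  proof -
    obtain W where "open W" "x \<in> W" "y \<notin> W"
      using t1_space[OF \<open>x \<noteq> y\<close>] by blast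
    then obtain V where "V \<in> \<B>" "x \<in> V" "y \<notin> V"
      using topological_basisE[OF basis] by (metis subsetD)
    then show ?thesis
      using from_nat_into_surj[OF \<open>countable \<B>\<close>] by metis
  qed
  then show ?thesis
    by blast
qed

theorem mainTheorem2:
  shows "\<exists>\<rho> :: real ^ 'n \<Rightarrow> real ^ 'n \<Rightarrow> real.
           Metric_space (UNIV :: (real ^ 'n) set) \<rho> \<and>
           hausdorff_outer_measure UNIV \<rho> CARD('n) (UNIV :: (real ^ 'n) set) = 0"
proof -
  obtain B :: "nat \<Rightarrow> (real ^ 'n) set"
    where "\<And>x y. x \<noteq> y \<Longrightarrow> \<exists>j. (x \<in> B j) \<noteq> (y \<in> B j)"
    using countable_separating_sets by metis
  then have "Metric_space UNIV (cantor_dist B)"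
    by (rule Metric_space_cantor_dist)
  \<comment> \<open>The index type is finite and nonempty, so the dimension \<open>CARD('n)\<close>
    is at least 1.\<close>
  moreover have "hausdorff_outer_measure UNIV (cantor_dist B) CARD('n) UNIV = 0"
    by (rule hausdorff_outer_measure_cantor_dist) (simp add: Suc_leI)
  ultimately show ?thesis
    by blast
qed

end
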